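(* Every finite simple undirected graph $G=(V,E)$ is Hamming-representable; that is, there exist positive integers $k\leq n$ such that $G$ is isomorphic to an induced subgraph of $H(n,k)$.
   Context: For a positive integer $n$ and $x,y\in\{0,1\}^n$, the Hamming distance of $x,y$ is the cardinality of the set $\{i\in\{0,\ldots,n-1\} : x(i)\neq y(i)\}$. For positive integers $k\leq n$, $H(n,k)$ denotes the graph with vertex set $\{0,1\}^n$ in which two distinct elements of $\{0,1\}^n$ form an edge if and only if their Hamming distance is at most $k$. A finite graph $G=(V,E)$ is called Hamming-representable if there are positive integers $k\leq n$ such that $G$ is isomorphic to an induced subgraph of $H(n,k)$. *)

theory Defs
  imports "Graph_Theory.Graph_Theory" "HOL-Library.FuncSet"
begin

text \<open>
  Finite simple undirected graphs are rendered by the locale \<^locale>\<open>graph\<close>: finite digraphs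
  without loops or parallel arcs whose arc relation is symmetric, so that an undirected edge
  \<open>{x, y}\<close> is the pair of arcs from \<open>x\<close> to \<open>y\<close> and from \<open>y\<close> to \<open>x\<close>.
\<close>

text \<open>
  Words are extensional functions, so that equality of functions is equality of words and
  distinct words of length \<open>n\<close> have positive Hamming distance.
\<close>

definition binary_words :: "nat \<Rightarrow> (nat \<Rightarrow> nat) set" where
  "binary_words n = {0..<n} \<rightarrow>\<^sub>E {0, 1}"

definition hamming_dist :: "nat \<Rightarrow> (nat \<Rightarrow> nat) \<Rightarrow> (nat \<Rightarrow> nat) \<Rightarrow> nat" where
  "hamming_dist n x y = card {i \<in> {0..<n}. x i \<noteq> y i}"

definition hamming_graph :: "nat \<Rightarrow> nat \<Rightarrow> (nat \<Rightarrow> nat) pair_pre_digraph" where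
  "hamming_graph n k =
    \<lparr> pverts = binary_words n,
      parcs = {(x, y). x \<in> binary_words n \<and> y \<in> binary_words n \<and>
                       x \<noteq> y \<and> hamming_dist n x y \<le> k} \<rparr>"

definition hamming_representable :: "('a, 'b) pre_digraph \<Rightarrow> bool" where
  "hamming_representable G \<longleftrightarrow>
    (\<exists>n k S. 0 < k \<and> k \<le> n \<and>
       induced_subgraph S (with_proj (hamming_graph n k)) \<and> digraph_iso G S)"

lemma finite_binary_words: "finite (binary_words n)"
  unfolding binary_words_def by (rule finite_PiE) simp_all

lemma hamming_dist_commute: "hamming_dist n x y = hamming_dist n y x"
proof -
  have "{i \<in> {0..<n}. x i \<noteq> y i} = {i \<in> {0..<n}. y i \<noteq> x i}"
    by auto
  then show ?thesis
    by (simp only: hamming_dist_def)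
qed

lemma graph_hamming_graph: "graph (with_proj (hamming_graph n k))"
proof -
  have fin: "finite (parcs (hamming_graph n k))"
    by (rule finite_subset[of _ "binary_words n \<times> binary_words n"])
      (auto simp: hamming_graph_def finite_binary_words)
  have sym: "symmetric (with_proj (hamming_graph n k))"
    unfolding symmetric_def with_proj_simps
  proof (rule symI)
    fix x y assume "(x, y) \<in> parcs (hamming_graph n k)"
    then show "(y, x) \<in> parcs (hamming_graph n k)"
      using hamming_dist_commute[of n x y] by (auto simp: hamming_graph_def)
  qed
  have "pair_graph (hamming_graph n k)"
    by unfold_locales
      (use fin sym in \<open>auto simp: hamming_graph_def finite_binary_words\<close>)
  then show ?thesis
    by (rule pair_graph.pair_graphD_graph)
qed

end

theory Submission
  imports Defs
begin

text \<open>
  A \<open>0\<close>-\<open>1\<close> word is the characteristic function of a set of coordinates, and the Hamming distance of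
  two words is the size of the symmetric difference of the two sets. It therefore suffices to
  attach to every vertex a finite set such that all these sets have the same size and the sets
  of two distinct vertices intersect if and only if the vertices are adjacent, and then in exactly
  one element: if the common size is \<open>m\<close>, adjacent vertices are at distance \<open>2 * m - 2\<close>,
  non-adjacent ones at distance \<open>2 * m\<close>, and the threshold \<open>k = 2 * m - 1\<close> separates them.

  Such sets are obtained by letting \<open>v\<close> collect one token for every vertex \<open>w\<close>. The token is
  shared between \<open>v\<close> and \<open>w\<close> if the two are adjacent, and private to \<open>v\<close> otherwise. All sets then
  have the size of the vertex set, and only the token of an edge lies in more than one of them.
\<close>

text \<open>
  An arc is sent to the pair of words of its ends. This is injective because there are no parallel
  arcs, and \<open>G\<close> is thereby isomorphic to the subgraph induced on the words of its vertices.
\<close>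

lemma hamming_representable_if_words:
  assumes "graph G" and "0 < k" "k \<le> n"
    and words: "\<And>u. u \<in> verts G \<Longrightarrow> f u \<in> binary_words n"
    and inj: "inj_on f (verts G)"
    and adj: "\<And>u v. \<lbrakk>u \<in> verts G; v \<in> verts G; u \<noteq> v\<rbrakk> \<Longrightarrow>
      u \<rightarrow>\<^bsub>G\<^esub> v \<longleftrightarrow> hamming_dist n (f u) (f v) \<le> k"
  shows "hamming_representable G"
proof -
  interpret G: graph G by fact
  define hom where "hom = \<lparr> iso_verts = f,
    iso_arcs = (\<lambda>a. (f (tail G a), f (head G a))),
    iso_head = snd, iso_tail = fst \<rparr>"
  have "inj_on (\<lambda>a. (f (tail G a), f (head G a))) (arcs G)"
    using inj by (intro inj_onI G.no_multi_arcs) (auto simp: arc_to_ends_def dest: inj_onD)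
  then have hom: "G.digraph_isomorphism hom"
    using inj by (simp add: G.digraph_isomorphism_def hom_def G.wf_digraph)
  have arcs: "iso_arcs hom ` arcs G = {(x, y). x \<in> f ` verts G \<and> y \<in> f ` verts G \<and>
      x \<noteq> y \<and> hamming_dist n x y \<le> k}" (is "?L = ?R")
  proof
    show "?L \<subseteq> ?R"
    proof
      fix p assume "p \<in> ?L"
      then obtain a where a: "a \<in> arcs G" "p = (f (tail G a), f (head G a))"
        by (auto simp: hom_def)
      then have "tail G a \<noteq> head G a" "tail G a \<in> verts G" "head G a \<in> verts G"
        "tail G a \<rightarrow>\<^bsub>G\<^esub> head G a"
        using G.no_loops by (auto simp: G.in_arcs_imp_in_arcs_ends)
      then show "p \<in> ?R"
        using a adj inj by (auto dest: inj_onD)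
    qed
    show "?R \<subseteq> ?L"
    proof
      fix p assume "p \<in> ?R"
      then obtain u v where "u \<in> verts G" "v \<in> verts G" "p = (f u, f v)" "u \<rightarrow>\<^bsub>G\<^esub> v"
        using adj by auto
      then show "p \<in> ?L"
        by (auto simp: hom_def)
    qed
  qed
  interpret H: graph "with_proj (hamming_graph n k)"
    by (rule graph_hamming_graph)
  have "app_iso hom G = with_proj (hamming_graph n k) \<restriction> (f ` verts G)"
    using arcs words
    by (auto simp: app_iso_def induce_subgraph_def hom_def hamming_graph_def)
  moreover have "f ` verts G \<subseteq> verts (with_proj (hamming_graph n k))"
    using words by (auto simp: hamming_graph_def)
  ultimately have "induced_subgraph (app_iso hom G) (with_proj (hamming_graph n k))"
    by (simp add: H.induced_induce)
  then show ?thesis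
    using assms(2,3) hom unfolding hamming_representable_def digraph_iso_def by blast
qed

text \<open>
  Numbering the elements of the sets turns each set into the word of its characteristic function,
  and symmetric differences into Hamming distances.
\<close>

lemma hamming_representable_if_sets:
  fixes A :: "'a \<Rightarrow> 'c set"
  assumes "graph G" and "0 < k"
    and fin: "\<And>u. u \<in> verts G \<Longrightarrow> finite (A u)"
    and inj: "inj_on A (verts G)"
    and adj: "\<And>u v. \<lbrakk>u \<in> verts G; v \<in> verts G; u \<noteq> v\<rbrakk> \<Longrightarrow>
      u \<rightarrow>\<^bsub>G\<^esub> v \<longleftrightarrow> card ((A u - A v) \<union> (A v - A u)) \<le> k"
  shows "hamming_representable G"
proof -
  interpret G: graph G by fact
  define I where "I = (\<Union>u\<in>verts G. A u)"
  have "finite I" using fin by (simp add: I_def)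
  then obtain e where e: "bij_betw e I {0..<card I}"
    using ex_bij_betw_finite_nat by blast
  have sub: "A u \<subseteq> I" if "u \<in> verts G" for u
    using that by (auto simp: I_def)
  \<comment> \<open>The coordinates from \<open>card I\<close> on carry a \<open>0\<close> in every word; they only serve to make the
    length at least \<open>k\<close>.\<close>
  define n where "n = card I + k"
  define f where "f = (\<lambda>u. \<lambda>i\<in>{0..<n}. if i \<in> e ` A u then 1 else 0 :: nat)"
  have e_image: "e ` B \<subseteq> {0..<n}" if "B \<subseteq> I" for B
  proof -
    have "e ` B \<subseteq> {0..<card I}"
      using that e by (auto simp: bij_betw_def)
    then show ?thesis by (auto simp: n_def)
  qed
  have e_diff: "e ` (A u - A v) = e ` A u - e ` A v" if "u \<in> verts G" "v \<in> verts G" for u v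
    using inj_on_image_set_diff[of e I "A u" "A v"] sub that e by (auto simp: bij_betw_def)
  have dist: "hamming_dist n (f u) (f v) = card ((A u - A v) \<union> (A v - A u))"
    if uv: "u \<in> verts G" "v \<in> verts G" for u v
  proof -
    have "{i \<in> {0..<n}. f u i \<noteq> f v i} = {0..<n} \<inter> ((e ` A u - e ` A v) \<union> (e ` A v - e ` A u))"
      unfolding f_def by (rule set_eqI) simp
    also have "\<dots> = (e ` A u - e ` A v) \<union> (e ` A v - e ` A u)"
      using e_image[OF sub[OF uv(1)]] e_image[OF sub[OF uv(2)]] by blast
    also have "\<dots> = e ` ((A u - A v) \<union> (A v - A u))"
      by (simp only: image_Un e_diff uv)
    finally have "{i \<in> {0..<n}. f u i \<noteq> f v i} = e ` ((A u - A v) \<union> (A v - A u))" .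
    moreover have "inj_on e ((A u - A v) \<union> (A v - A u))"
      by (rule inj_on_subset[of e I]) (use e sub[OF uv(1)] sub[OF uv(2)] in \<open>auto simp: bij_betw_def\<close>)
    ultimately show ?thesis
      by (simp add: hamming_dist_def card_image)
  qed
  have "inj_on f (verts G)"
  proof (rule inj_onI)
    fix u v assume uv: "u \<in> verts G" "v \<in> verts G" "f u = f v"
    then have "card ((A u - A v) \<union> (A v - A u)) = 0"
      using dist[of u v] by (simp add: hamming_dist_def)
    then have "A u = A v" using fin uv by auto
    then show "u = v" using inj uv by (auto dest: inj_onD)
  qed
  then show ?thesis
    using \<open>graph G\<close> \<open>0 < k\<close> adj dist
    by (intro hamming_representable_if_words[of G k n f])
      (auto simp: n_def f_def binary_words_def)
qed

text \<open>
  An adjacent pair is represented without orientation, so that \<open>v\<close> and \<open>w\<close> produce the same token;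
  a non-adjacent pair keeps its orientation, so that its first component identifies the owner.
\<close>

definition token :: "('a, 'b) pre_digraph \<Rightarrow> 'a \<Rightarrow> 'a \<Rightarrow> ('a \<times> 'a) set" where
  "token G v w = (if v \<rightarrow>\<^bsub>G\<^esub> w then {(v, w), (w, v)} else {(v, w)})"

definition tokens :: "('a, 'b) pre_digraph \<Rightarrow> 'a \<Rightarrow> ('a \<times> 'a) set set" where
  "tokens G v = token G v ` verts G"

lemma card_tokens: "card (tokens G v) = card (verts G)"
proof -
  have "inj_on (token G v) (verts G)"
    by (rule inj_onI) (auto simp: token_def doubleton_eq_iff split: if_splits)
  then show ?thesis by (simp add: tokens_def card_image)
qed

text \<open>
  A token in both sets is a token for a pair containing \<open>u\<close> and \<open>v\<close>, and only for an adjacent pair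
  do both ends produce the same one.
\<close>

lemma tokens_Int:
  assumes "graph G" "u \<in> verts G" "v \<in> verts G" "u \<noteq> v"
  shows "tokens G u \<inter> tokens G v = (if u \<rightarrow>\<^bsub>G\<^esub> v then {token G u v} else {})"
proof -
  interpret G: graph G by fact
  have sym: "x \<rightarrow>\<^bsub>G\<^esub> y \<longleftrightarrow> y \<rightarrow>\<^bsub>G\<^esub> x" for x y
    using G.sym_arcs by (auto simp: symmetric_def dest: symD)
  have "token G u w = token G v x \<longleftrightarrow> w = v \<and> x = u \<and> u \<rightarrow>\<^bsub>G\<^esub> v" for w x
    using \<open>u \<noteq> v\<close> sym by (auto simp: token_def doubleton_eq_iff)
  then show ?thesis
    using assms(2,3) by (auto simp: tokens_def)
qed

theorem proposition2p1:
  fixes G :: "('a, 'b) pre_digraph"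
  assumes "graph G"
  shows "hamming_representable G"
proof -
  interpret G: graph G by fact
  have fin: "finite (tokens G u)" for u by (simp add: tokens_def)
  define m where "m = card (verts G)"
  have m_pos: "0 < m" if "u \<in> verts G" for u
    using that by (auto simp: m_def card_gt_0_iff)
  have card_symdiff: "card ((tokens G u - tokens G v) \<union> (tokens G v - tokens G u)) =
      (if u \<rightarrow>\<^bsub>G\<^esub> v then 2 * m - 2 else 2 * m)"
    if uv: "u \<in> verts G" "v \<in> verts G" "u \<noteq> v" for u v
  proof -
    have "card ((tokens G u - tokens G v) \<union> (tokens G v - tokens G u)) =
        card (tokens G u - tokens G v) + card (tokens G v - tokens G u)"
      by (rule card_Un_disjoint) (auto simp: fin)
    also have "\<dots> = (m - card (tokens G u \<inter> tokens G v)) + (m - card (tokens G u \<inter> tokens G v))"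
      by (simp add: card_Diff_subset_Int fin card_tokens m_def Int_commute)
    finally show ?thesis
      using uv by (auto simp: tokens_Int[OF \<open>graph G\<close>])
  qed
  have "inj_on (tokens G) (verts G)"
  proof (rule inj_onI)
    fix u v assume uv: "u \<in> verts G" "v \<in> verts G" "tokens G u = tokens G v"
    \<comment> \<open>The token of \<open>u\<close> for \<open>u\<close> itself lies in no other set, so it tells \<open>u\<close> apart.\<close>
    have "token G u u \<in> tokens G v" using uv by (auto simp: tokens_def)
    moreover have "token G u u = {(u, u)}" by (simp add: token_def)
    ultimately show "u = v" by (auto simp: tokens_def token_def split: if_splits)
  qed
  moreover have "u \<rightarrow>\<^bsub>G\<^esub> v \<longleftrightarrow>
      card ((tokens G u - tokens G v) \<union> (tokens G v - tokens G u)) \<le> max 1 (2 * m - 1)"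
    if "u \<in> verts G" "v \<in> verts G" "u \<noteq> v" for u v
    unfolding card_symdiff[OF that] using m_pos[OF that(1)] by (simp split: if_split) linarith
  \<comment> \<open>The maximum makes the threshold positive for the null graph as well.\<close>
  ultimately show ?thesis
    by (intro hamming_representable_if_sets[OF \<open>graph G\<close>, of "max 1 (2 * m - 1)" "tokens G"] fin) simp_all
qed

end
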